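(* For every integer $d\ge1$ there exists a countable family of profiles $\{W_n\}_{n\in\mathbb{N}}$, $W_n:\mathbb{R}\times\overline{\mathbb{B}^d_1}\to\mathbb{S}^1$, such that $W_n\in C^\infty\times C^\infty(\mathbb{R}\times\overline{\mathbb{B}^d_1})$, $W_n$ is periodic in its first variable (i.e. $W_n(\tau+\mathcal{T},\xi)=W_n(\tau,\xi)$ for some $\mathcal{T}>0$ and all $(\tau,\xi)$), and $$U(t,x)=W_n(\tau,\xi),\qquad \tau=-\ln(-t),\quad \xi=\frac{x}{-t},$$ is a discretely self-similar solution of the system $$-\partial_t^2U_1+\Delta U_1+(U_1+U_2)\,Q(U)=0,\qquad -\partial_t^2U_2+\Delta U_2+(U_2-U_1)\,Q(U)=0,$$ $$Q(U)=\sum_{i=1}^{2}\big(-(\partial_tU_i)^2+|\nabla U_i|^2\big),\qquad U_1^2+U_2^2=1,$$ which is smooth on $\Gamma^-$ and blows up at $(0,0)$. The profiles $W_n$ are explicitly given by $$W_n(\tau,\xi)=\big(\sin(\ln[\phi_n(|\xi|)]-n\tau),\ \cos(\ln[\phi_n(|\xi|)]-n\tau)\big),$$ where $\phi_n$ is a positive and even polynomial defined by the finite hypergeometric sum $$\phi_n(\rho)=\sum_{j=0}^{\lfloor n/2\rfloor}\frac{(-\frac n2)_j(\frac{1-n}{2})_j}{(\frac d2)_j\,j!}\rho^{2j}={}_2F_1\Big(\frac{1-n}{2},-\frac n2;\frac d2;\rho^2\Big).$$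
   Context: $\mathbb{N}=\{1,2,\dots\}$. $(a)_j=a(a+1)\cdots(a+j-1)$ with $(a)_0=1$. $\mathbb{S}^1\subset\mathbb{R}^2$ is the unit circle and $\mathbb{B}^d_1$ the open unit ball of $\mathbb{R}^d$. $\Gamma^-:=\{(t,x)\in\mathbb{R}^{1+d}:t<0,\ |x|\le -t\}$. With $U_\lambda(t,x):=U(t/\lambda,x/\lambda)$, a solution $U$ on $\Gamma^-$ is called discretely self-similar if $U=U_\lambda$ holds only for a non-empty discrete set of positive values $\lambda\neq1$ (in addition to $\lambda=1$). Blowup at $(0,0)$ means loss of smoothness at the origin as $t\to0^-$. *)

theory Defs
  imports "HOL-Analysis.Analysis"
begin

primrec C_on :: "nat \<Rightarrow> 'a::real_normed_vector set \<Rightarrow> ('a \<Rightarrow> 'b::real_normed_vector) \<Rightarrow> bool" where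
  "C_on 0 V f \<longleftrightarrow> continuous_on V f"
| "C_on (Suc k) V f \<longleftrightarrow>
     (\<forall>p\<in>V. f differentiable (at p)) \<and> (\<forall>v. C_on k V (\<lambda>p. frechet_derivative f (at p) v))"

text \<open>Smoothness on a set that need not be open (such as a closed ball or a cone including its
  lateral boundary): restriction of a smooth function on an open neighbourhood. In particular
  it does not depend on the values of the function off the set.\<close>

definition smooth_on :: "'a::real_normed_vector set \<Rightarrow> ('a \<Rightarrow> 'b::real_normed_vector) \<Rightarrow> bool" where
  "smooth_on S f \<longleftrightarrow>
     (\<exists>V g. open V \<and> S \<subseteq> V \<and> (\<forall>k. C_on k V g) \<and> (\<forall>p\<in>S. g p = f p))"

text \<open>Spacetime is \<open>real \<times> (real^'d)\<close>, with points \<open>(t, x)\<close>.\<close>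

definition past_cone :: "(real \<times> (real^'d)) set" where
  "past_cone = {(t, x). t < 0 \<and> norm x \<le> - t}"

text \<open>Derivatives of functions on the cone are taken within the cone: on its lateral boundary they
  are the one-sided ones. They are unique there, as the cone is convex with nonempty interior, and
  on the interior they are the ordinary derivatives.\<close>

definition cone_deriv ::
    "real \<times> (real^'d) \<Rightarrow> (real \<times> (real^'d) \<Rightarrow> real) \<Rightarrow> real \<times> (real^'d) \<Rightarrow> real" where
  "cone_deriv v f p = frechet_derivative f (at p within past_cone) v"

definition d_t :: "(real \<times> (real^'d) \<Rightarrow> real) \<Rightarrow> real \<times> (real^'d) \<Rightarrow> real" where
  "d_t = cone_deriv (1, 0)"

definition d_x :: "'d \<Rightarrow> (real \<times> (real^'d) \<Rightarrow> real) \<Rightarrow> real \<times> (real^'d) \<Rightarrow> real" where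
  "d_x i = cone_deriv (0, axis i 1)"

definition grad_x :: "(real \<times> (real^'d) \<Rightarrow> real) \<Rightarrow> real \<times> (real^'d) \<Rightarrow> real^'d" where
  "grad_x f p = (\<chi> i. d_x i f p)"

definition laplace_x :: "(real \<times> (real^'d) \<Rightarrow> real) \<Rightarrow> real \<times> (real^'d) \<Rightarrow> real" where
  "laplace_x f p = (\<Sum>i\<in>UNIV. d_x i (d_x i f) p)"

definition component :: "(real \<times> (real^'d) \<Rightarrow> real^2) \<Rightarrow> 2 \<Rightarrow> real \<times> (real^'d) \<Rightarrow> real" where
  "component U i p = U p $ i"

definition Q_form :: "(real \<times> (real^'d) \<Rightarrow> real^2) \<Rightarrow> real \<times> (real^'d) \<Rightarrow> real" where
  "Q_form U p = (\<Sum>i\<in>UNIV. - (d_t (component U i) p)\<^sup>2 + (norm (grad_x (component U i) p))\<^sup>2)"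

definition solves_system :: "(real \<times> (real^'d) \<Rightarrow> real^2) \<Rightarrow> bool" where
  "solves_system U \<longleftrightarrow> (\<forall>p\<in>past_cone.
     - d_t (d_t (component U 1)) p + laplace_x (component U 1) p + (U p $ 1 + U p $ 2) * Q_form U p = 0 \<and>
     - d_t (d_t (component U 2)) p + laplace_x (component U 2) p + (U p $ 2 - U p $ 1) * Q_form U p = 0 \<and>
     (U p $ 1)\<^sup>2 + (U p $ 2)\<^sup>2 = 1)"

definition rescale :: "real \<Rightarrow> (real \<times> (real^'d) \<Rightarrow> real^2) \<Rightarrow> real \<times> (real^'d) \<Rightarrow> real^2" where
  "rescale \<mu> U = (\<lambda>(t, x). U (t / \<mu>, x /\<^sub>R \<mu>))"

definition discretely_self_similar :: "(real \<times> (real^'d) \<Rightarrow> real^2) \<Rightarrow> bool" where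
  "discretely_self_similar U \<longleftrightarrow>
     (let \<Lambda> = {\<mu>. \<mu> > 0 \<and> \<mu> \<noteq> 1 \<and> (\<forall>p\<in>past_cone. U p = rescale \<mu> U p)}
      in \<Lambda> \<noteq> {} \<and> discrete \<Lambda>)"

text \<open>Loss of smoothness at the origin: near the origin, the restriction of \<open>U\<close> to the cone is not
  the restriction of any function that is smooth around the origin.\<close>

definition blows_up_at_origin :: "(real \<times> (real^'d) \<Rightarrow> real^2) \<Rightarrow> bool" where
  "blows_up_at_origin U \<longleftrightarrow>
     \<not> (\<exists>N g. open N \<and> (0, 0) \<in> N \<and> smooth_on N g \<and> (\<forall>p\<in>N \<inter> past_cone. g p = U p))"

definition of_profile :: "(real \<Rightarrow> real^'d \<Rightarrow> real^2) \<Rightarrow> real \<times> (real^'d) \<Rightarrow> real^2" where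
  "of_profile w = (\<lambda>(t, x). w (- ln (- t)) (x /\<^sub>R (- t)))"

definition phi :: "nat \<Rightarrow> nat \<Rightarrow> real \<Rightarrow> real" where
  "phi d n \<rho> = (\<Sum>j = 0..n div 2.
     pochhammer (- (real n / 2)) j * pochhammer ((1 - real n) / 2) j /
     (pochhammer (real d / 2) j * fact j) * \<rho> ^ (2 * j))"

definition hyp2F1 :: "real \<Rightarrow> real \<Rightarrow> real \<Rightarrow> real \<Rightarrow> real" where
  "hyp2F1 a b c z = eval_fps (fps_hypergeo [a, b] [c] 1) z"

end

theory Submission
  imports Defs
begin

text \<open>
  Write \<open>U = (sin \<theta>, cos \<theta>)\<close> and let \<open>\<box> = - \<partial>\<^sub>t\<^sup>2 + \<Delta>\<close>. Then
  \<open>Q(U) = - (\<partial>\<^sub>t \<theta>)\<^sup>2 + \<bar>\<nabla> \<theta>\<bar>\<^sup>2\<close>, and the two equations become \<open>cos \<theta>\<close> and \<open>- sin \<theta>\<close>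
  times the single scalar equation \<open>\<box> \<theta> + Q(U) = 0\<close>. The substitution \<open>\<theta> = ln F\<close>
  linearizes it: \<open>\<box> (ln F) = \<box> F / F - Q(U)\<close>, so every positive solution \<open>F\<close> of the free wave
  equation yields a solution of the system (\<open>solves_system_of_wave\<close>).

  The profile with index \<open>n\<close> comes from the wave polynomial
  \<open>F(t, x) = \<Sum> c\<^sub>j (- t)\<^bsup>n - 2 j\<^esup> \<bar>x\<bar>\<^bsup>2 j\<^esup>\<close>, whose coefficients are those of the hypergeometric
  polynomial \<open>phi\<close>. Applying \<open>\<partial>\<^sub>t\<^sup>2\<close> to one term and \<open>\<Delta>\<close> to the next produces multiples of the
  same monomial, and the recursion for hypergeometric coefficients says exactly that they cancel
  (\<open>wave_poly_wave_equation\<close>). All \<open>c\<^sub>j\<close> are nonnegative because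
  \<open>4 (- n / 2 + j) ((1 - n) / 2 + j) = (n - 2 j) (n - 2 j - 1)\<close> is a product of two consecutive
  integers; hence \<open>F > 0\<close> for \<open>t < 0\<close>.

  As \<open>F\<close> is homogeneous of degree \<open>n\<close>, \<open>F(t, x) = (- t)\<^bsup>n\<^esup> \<phi>(\<bar>x\<bar> / (- t))\<close>, and taking
  logarithms gives \<open>\<theta> = ln \<phi>(\<bar>\<xi>\<bar>) - n \<tau>\<close>, the phase in the theorem. Rescaling by \<open>\<mu>\<close> shifts this
  phase by \<open>n ln \<mu>\<close>, so \<open>U\<close> is invariant exactly for \<open>\<mu> = exp (2 \<pi> k / n)\<close> with \<open>k\<close> an integer.
  Along the axis \<open>x = 0\<close> the map runs through the whole circle again and again as \<open>t\<close> tends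
  to \<open>0\<close>, so it has not even a continuous extension to the origin.
\<close>

section \<open>Calculus of \<open>C\<^sup>k\<close> functions\<close>

lemma C_on_Suc_imp: "C_on (Suc k) V f \<Longrightarrow> C_on k V f"
proof (induction k arbitrary: f)
  case 0
  then show ?case
    by (auto intro!: continuous_at_imp_continuous_on differentiable_imp_continuous_within)
next
  case (Suc k)
  then show ?case by (metis C_on.simps(2))
qed

lemma C_on_cong:
  assumes "open V" "\<And>p. p \<in> V \<Longrightarrow> f p = g p" "C_on k V f"
  shows "C_on k V g"
  using assms(2,3)
proof (induction k arbitrary: f g)
  case 0
  then show ?case using continuous_on_cong by force
next
  case (Suc k)
  have "g differentiable (at p)" if "p \<in> V" for p
    using has_derivative_transform_within_open[OF _ assms(1) that] Suc.prems that
    unfolding differentiable_def C_on.simps by metis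
  moreover have "C_on k V (\<lambda>p. frechet_derivative g (at p) v)" for v
  proof (rule Suc.IH)
    show "C_on k V (\<lambda>p. frechet_derivative f (at p) v)" using Suc.prems(2) by simp
    show "frechet_derivative f (at p) v = frechet_derivative g (at p) v" if "p \<in> V" for p
      using frechet_derivative_transform_within_open[OF _ assms(1) that, of f g] Suc.prems that
      by simp
  qed
  ultimately show ?case by simp
qed

text \<open>Every closure property below is proved by induction on the order of differentiability through
  this rule: exhibit a derivative whose directional values are \<open>C\<^sup>k\<close> by the induction hypothesis.
  The derivative is prescribed on \<open>V\<close> only, which suffices as \<open>V\<close> is open.\<close>

lemma C_on_SucI:
  assumes "open V" "\<And>p. p \<in> V \<Longrightarrow> (f has_derivative f' p) (at p)"
    and "\<And>v. C_on k V (\<lambda>p. f' p v)"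
  shows "C_on (Suc k) V f"
proof -
  have "frechet_derivative f (at p) = f' p" if "p \<in> V" for p
    using frechet_derivative_at[OF assms(2)[OF that]] by simp
  then have "C_on k V (\<lambda>p. frechet_derivative f (at p) v)" for v
    by (intro C_on_cong[OF assms(1) _ assms(3)[of v]]) simp
  then show ?thesis using assms(2) by (auto simp: differentiable_def)
qed

lemma C_on_Suc_has_derivative:
  assumes "C_on (Suc k) V f" "p \<in> V"
  shows "(f has_derivative frechet_derivative f (at p)) (at p)"
  using assms by (simp add: frechet_derivative_works)

lemma C_on_const: "open V \<Longrightarrow> C_on k V (\<lambda>_. c)"
proof (induction k arbitrary: c)
  case (Suc k)
  show ?case by (rule C_on_SucI[where f' = "\<lambda>_ _. 0"]) (use Suc in auto)
qed simp

lemma C_on_bounded_linear: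
  assumes "open V" "bounded_linear L" "C_on k V f"
  shows "C_on k V (\<lambda>p. L (f p))"
  using assms(3)
proof (induction k arbitrary: f)
  case 0
  then show ?case
    using linear_continuous_on[OF assms(2)] by (auto intro: continuous_on_compose2[where t=UNIV])
next
  case (Suc k)
  show ?case
  proof (rule C_on_SucI[OF assms(1)])
    show "((\<lambda>p. L (f p)) has_derivative (\<lambda>v. L (frechet_derivative f (at p) v))) (at p)"
      if "p \<in> V" for p
      by (rule bounded_linear.has_derivative[OF assms(2) C_on_Suc_has_derivative[OF Suc.prems that]])
    show "C_on k V (\<lambda>p. L (frechet_derivative f (at p) v))" for v
      using Suc by simp
  qed
qed

lemma C_on_id: "open V \<Longrightarrow> C_on k V (\<lambda>p. p)"
proof (cases k)
  case (Suc k)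
  assume "open V"
  then show ?thesis unfolding Suc
    by (intro C_on_SucI[where f' = "\<lambda>_ v. v"] C_on_const) (auto intro: has_derivative_ident)
qed auto

lemma C_on_add:
  assumes "open V" "C_on k V f" "C_on k V g"
  shows "C_on k V (\<lambda>p. f p + g p)"
  using assms(2,3)
proof (induction k arbitrary: f g)
  case 0
  then show ?case by (auto intro: continuous_intros)
next
  case (Suc k)
  show ?case
  proof (rule C_on_SucI[OF assms(1)])
    show "((\<lambda>p. f p + g p) has_derivative
        (\<lambda>v. frechet_derivative f (at p) v + frechet_derivative g (at p) v)) (at p)"
      if "p \<in> V" for p
      using Suc.prems that by (intro has_derivative_add C_on_Suc_has_derivative)
  qed (use Suc in simp)
qed

lemma C_on_sum:
  assumes "open V" "\<And>i. i \<in> A \<Longrightarrow> C_on k V (f i)"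
  shows "C_on k V (\<lambda>p. \<Sum>i\<in>A. f i p)"
  using assms(2)
  by (induction A rule: infinite_finite_induct) (auto intro: C_on_add C_on_const assms(1))

text \<open>By the product rule the derivative is a sum of terms of the same shape, each containing one
  differentiated and one undifferentiated factor; the latter has an order to spare. Multiplication,
  inner product and scaling are the instances needed.\<close>

lemma C_on_bilinear:
  assumes "open V" "bounded_bilinear B" "C_on k V f" "C_on k V g"
  shows "C_on k V (\<lambda>p. B (f p) (g p))"
  using assms(3,4)
proof (induction k arbitrary: f g)
  case 0
  then show ?case by (auto intro: bounded_bilinear.continuous_on[OF assms(2)])
next
  case (Suc k)
  show ?case
  proof (rule C_on_SucI[OF assms(1)])
    show "((\<lambda>p. B (f p) (g p)) has_derivative
        (\<lambda>v. B (f p) (frechet_derivative g (at p) v) + B (frechet_derivative f (at p) v) (g p))) (at p)"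
      if "p \<in> V" for p
      using Suc.prems that by (intro bounded_bilinear.FDERIV[OF assms(2)] C_on_Suc_has_derivative)
    show "C_on k V (\<lambda>p. B (f p) (frechet_derivative g (at p) v) + B (frechet_derivative f (at p) v) (g p))"
      for v
      using Suc.prems C_on_Suc_imp[of k V f] C_on_Suc_imp[of k V g]
      by (intro C_on_add[OF assms(1)] Suc.IH) auto
  qed
qed

lemmas C_on_mult = C_on_bilinear[OF _ bounded_bilinear_mult]

lemma C_on_power:
  fixes f :: "'a::real_normed_vector \<Rightarrow> real"
  assumes "open V" "C_on k V f"
  shows "C_on k V (\<lambda>p. f p ^ m)"
  by (induction m) (auto intro: C_on_const C_on_mult assms)

text \<open>Sine and cosine are treated together because each occurs in the derivative of the other.\<close>

lemma C_on_sin_cos: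
  fixes f :: "'a::real_normed_vector \<Rightarrow> real"
  assumes "open V" "C_on k V f"
  shows "C_on k V (\<lambda>p. sin (f p)) \<and> C_on k V (\<lambda>p. cos (f p))"
  using assms(2)
proof (induction k)
  case 0
  then show ?case by (auto intro: continuous_intros)
next
  case (Suc k)
  let ?D = "\<lambda>p. frechet_derivative f (at p)"
  have D: "(f has_derivative ?D p) (at p)" if "p \<in> V" for p
    using Suc.prems that by (rule C_on_Suc_has_derivative)
  have IH: "C_on k V (\<lambda>p. sin (f p))" "C_on k V (\<lambda>p. cos (f p))"
    and CD: "C_on k V (\<lambda>p. ?D p v)" for v
    using Suc C_on_Suc_imp by auto
  have "C_on (Suc k) V (\<lambda>p. sin (f p))"
  proof (rule C_on_SucI[OF assms(1)])
    show "((\<lambda>p. sin (f p)) has_derivative (\<lambda>v. cos (f p) * ?D p v)) (at p)" if "p \<in> V" for p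
      using D[OF that] by (auto intro!: derivative_eq_intros)
  qed (intro C_on_mult assms IH CD)
  moreover have "C_on (Suc k) V (\<lambda>p. cos (f p))"
  proof (rule C_on_SucI[OF assms(1)])
    show "((\<lambda>p. cos (f p)) has_derivative (\<lambda>v. -1 * (sin (f p) * ?D p v))) (at p)" if "p \<in> V" for p
      using D[OF that] by (auto intro!: derivative_eq_intros)
  qed (intro C_on_mult C_on_const assms IH CD)
  ultimately show ?case by simp
qed

lemma C_on_inverse:
  fixes f :: "'a::real_normed_vector \<Rightarrow> real"
  assumes "open V" "C_on k V f" and nz: "\<And>p. p \<in> V \<Longrightarrow> f p \<noteq> 0"
  shows "C_on k V (\<lambda>p. inverse (f p))"
  using assms(2)
proof (induction k)
  case 0
  then show ?case using nz by (auto intro: continuous_intros)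
next
  case (Suc k)
  let ?D = "\<lambda>p. frechet_derivative f (at p)"
  show ?case
  proof (rule C_on_SucI[OF assms(1)])
    show "((\<lambda>p. inverse (f p)) has_derivative
        (\<lambda>v. -1 * (inverse (f p) * (?D p v * inverse (f p))))) (at p)" if "p \<in> V" for p
      using C_on_Suc_has_derivative[OF Suc.prems that] nz[OF that]
      by (auto intro!: derivative_eq_intros)
    have "C_on k V (\<lambda>p. inverse (f p))" "C_on k V (\<lambda>p. ?D p v)" for v
      using Suc C_on_Suc_imp by auto
    then show "C_on k V (\<lambda>p. -1 * (inverse (f p) * (?D p v * inverse (f p))))" for v
      by (intro C_on_mult C_on_const assms(1))
  qed
qed

lemma C_on_ln:
  fixes f :: "'a::real_normed_vector \<Rightarrow> real"
  assumes "open V" "C_on k V f" and pos: "\<And>p. p \<in> V \<Longrightarrow> f p > 0"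
  shows "C_on k V (\<lambda>p. ln (f p))"
proof (cases k)
  case 0
  then show ?thesis using assms by (force intro!: continuous_intros)
next
  case (Suc m)
  let ?D = "\<lambda>p. frechet_derivative f (at p)"
  have f: "C_on (Suc m) V f" using assms Suc by simp
  show ?thesis unfolding Suc
  proof (rule C_on_SucI[OF assms(1)])
    show "((\<lambda>p. ln (f p)) has_derivative (\<lambda>v. inverse (f p) * ?D p v)) (at p)" if "p \<in> V" for p
      using C_on_Suc_has_derivative[OF f that] pos[OF that]
      by (auto intro!: derivative_eq_intros simp: field_simps)
    have "f p \<noteq> 0" if "p \<in> V" for p using pos[OF that] by simp
    then show "C_on m V (\<lambda>p. inverse (f p) * ?D p v)" for v
      using f by (intro C_on_mult C_on_inverse C_on_Suc_imp[OF f] assms(1)) auto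
  qed
qed

lemma vector_2_eq: "(vector [a, b] :: real^2) = a *\<^sub>R axis 1 1 + b *\<^sub>R axis 2 1"
  by (simp add: vec_eq_iff forall_2 axis_def)

lemma C_on_circle:
  fixes f :: "'a::real_normed_vector \<Rightarrow> real"
  assumes "open V" "C_on k V f"
  shows "C_on k V (\<lambda>p. vector [sin (f p), cos (f p)] :: real^2)"
  unfolding vector_2_eq
  using C_on_sin_cos[OF assms]
  by (auto intro!: C_on_add C_on_bilinear[OF _ bounded_bilinear_scaleR] C_on_const assms)

section \<open>Derivatives within the cone\<close>

text \<open>A derivative within \<open>S\<close> determines the one-sided derivative along any segment contained in \<open>S\<close>.\<close>

lemma has_derivative_within_unique_direction:
  fixes f :: "'a::real_normed_vector \<Rightarrow> 'b::real_normed_vector"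
  assumes S: "convex S" "p \<in> S" "q \<in> S"
    and f1: "(f has_derivative f1) (at p within S)"
    and f2: "(f has_derivative f2) (at p within S)"
  shows "f1 (q - p) = f2 (q - p)"
proof -
  define c where "c = (\<lambda>s::real. p + s *\<^sub>R (q - p))"
  have sub: "c ` {0..1} \<subseteq> S"
  proof
    fix y assume "y \<in> c ` {0..1}"
    then obtain s where s: "0 \<le> s" "s \<le> 1" "y = (1 - s) *\<^sub>R p + s *\<^sub>R q"
      by (auto simp: c_def algebra_simps)
    then show "y \<in> S" using convexD_alt[OF S] by auto
  qed
  have c: "(c has_derivative (\<lambda>s. s *\<^sub>R (q - p))) (at 0 within {0..1})"
    unfolding c_def by (auto intro!: derivative_eq_intros)
  have chain: "((\<lambda>s. f (c s)) has_vector_derivative g (q - p)) (at 0 within {0..1})"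
    if "(f has_derivative g) (at p within S)" for g
  proof -
    have "(f has_derivative g) (at (c 0) within c ` {0..1})"
      using has_derivative_subset[OF that sub] by (simp add: c_def)
    from diff_chain_within[OF c this]
    have "((\<lambda>s. f (c s)) has_derivative (\<lambda>s. g (s *\<^sub>R (q - p)))) (at 0 within {0..1})"
      by (simp add: o_def)
    then show ?thesis
      using linear_cmul[OF has_derivative_linear[OF that]]
      by (simp add: has_vector_derivative_def)
  qed
  have "at (0::real) within {0..1} \<noteq> bot"
    by (simp add: trivial_limit_within islimpt_Icc)
  then show ?thesis
    using vector_derivative_unique_within chain[OF f1] chain[OF f2] by blast
qed

text \<open>At a boundary point the coordinate axes may be tangent to \<open>S\<close> and leave it on both sides, as
  happens on the lateral boundary of the cone, so uniqueness cannot be tested along a fixed basis.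
  The directions towards the points of a ball in \<open>S\<close> can be used instead: the differences of such
  directions fill a neighbourhood of \<open>0\<close>.\<close>

lemma has_derivative_within_unique_convex:
  fixes f :: "'a::real_normed_vector \<Rightarrow> 'b::real_normed_vector"
  assumes S: "convex S" "interior S \<noteq> {}" "p \<in> S"
    and f1: "(f has_derivative f1) (at p within S)"
    and f2: "(f has_derivative f2) (at p within S)"
  shows "f1 = f2"
proof
  fix v :: 'a
  obtain q e where e: "e > 0" "ball q e \<subseteq> S"
    using S(2) mem_interior by blast
  \<comment> \<open>a step that stays in the ball around \<open>q\<close>; the summand \<open>1\<close> covers \<open>v = 0\<close>\<close>
  define \<delta> where "\<delta> = e / (norm v + 1)"
  have \<delta>: "\<delta> > 0" "\<delta> * norm v < e"
    using e(1) norm_ge_zero[of v] by (auto simp: \<delta>_def field_simps add_nonneg_pos simp del: norm_ge_zero)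
  have l1: "linear f1" and l2: "linear f2"
    using f1 f2 has_derivative_linear by auto
  have "q \<in> S" "q + \<delta> *\<^sub>R v \<in> S" using e \<delta> by (auto simp: dist_norm)
  then have "f1 (q - p) = f2 (q - p)" "f1 (q + \<delta> *\<^sub>R v - p) = f2 (q + \<delta> *\<^sub>R v - p)"
    using has_derivative_within_unique_direction[OF S(1) S(3) _ f1 f2] by blast+
  moreover have "q + \<delta> *\<^sub>R v - p = (q - p) + \<delta> *\<^sub>R v" by simp
  ultimately have "\<delta> *\<^sub>R f1 v = \<delta> *\<^sub>R f2 v"
    by (metis add_left_cancel linear_add[OF l1] linear_add[OF l2] linear_cmul[OF l1] linear_cmul[OF l2])
  then show "f1 v = f2 v" using \<delta>(1) by simp
qed

lemma convex_past_cone: "convex (past_cone :: (real \<times> (real^'d)) set)"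
proof (rule convexI)
  fix p q :: "real \<times> (real^'d)" and u v :: real
  assume p: "p \<in> past_cone" and q: "q \<in> past_cone" and uv: "0 \<le> u" "0 \<le> v" "u + v = 1"
  obtain t x s y where [simp]: "p = (t, x)" "q = (s, y)" by (metis prod.exhaust)
  have h: "t < 0" "s < 0" "norm x \<le> - t" "norm y \<le> - s" using p q by (auto simp: past_cone_def)
  have "u * t + v * s < 0"
  proof (cases "u = 0")
    case False
    then have "u * t < 0" "v * s \<le> 0" using h uv by (auto simp: mult_less_0_iff mult_le_0_iff)
    then show ?thesis by linarith
  qed (use h uv in auto)
  moreover have "norm (u *\<^sub>R x + v *\<^sub>R y) \<le> - (u * t + v * s)"
    using norm_triangle_ineq[of "u *\<^sub>R x" "v *\<^sub>R y"] uv
      mult_left_mono[OF h(3) uv(1)] mult_left_mono[OF h(4) uv(2)] by simp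
  ultimately show "u *\<^sub>R p + v *\<^sub>R q \<in> past_cone" by (simp add: past_cone_def)
qed

lemma interior_past_cone: "interior (past_cone :: (real \<times> (real^'d)) set) \<noteq> {}"
proof -
  let ?O = "{p :: real \<times> (real^'d). norm (snd p) < - fst p}"
  have "open ?O" by (intro open_Collect_less continuous_intros)
  moreover have "?O \<subseteq> past_cone"
  proof
    fix p assume "p \<in> ?O"
    then show "p \<in> past_cone" using norm_ge_zero[of "snd p"]
      by (auto simp: past_cone_def case_prod_unfold simp del: norm_ge_zero)
  qed
  moreover have "(-1, 0) \<in> ?O" by simp
  ultimately show ?thesis by (metis interior_maximal empty_iff subsetD)
qed

text \<open>This turns derivatives within the cone into ordinary ones. The function \<open>f\<close> has to agree with
  the differentiable function \<open>g\<close> on the cone alone, which lets the rule be iterated: a cone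
  derivative has a usable formula only on the cone.\<close>

lemma cone_deriv_eq:
  assumes "p \<in> past_cone" "(g has_derivative g') (at p)" "\<And>q. q \<in> past_cone \<Longrightarrow> f q = g q"
  shows "cone_deriv v f p = g' v"
proof -
  have g: "(f has_derivative g') (at p within past_cone)"
    using assms has_derivative_at_withinI[OF assms(2)] by (auto intro: has_derivative_transform)
  then have "(f has_derivative frechet_derivative f (at p within past_cone)) (at p within past_cone)"
    using frechet_derivative_works differentiable_def by blast
  from has_derivative_within_unique_convex[OF convex_past_cone interior_past_cone assms(1) this g]
  show ?thesis by (simp add: cone_deriv_def)
qed

section \<open>Reduction to the wave equation\<close>

text \<open>The chain rule for \<open>S (ln F)\<close>, in one direction \<open>v\<close>. Both components of \<open>U\<close> have this form,
  with \<open>S\<close> the sine or the cosine.\<close>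

lemma cone_deriv_component:
  assumes pc: "p \<in> past_cone"
    and U: "\<And>q. q \<in> past_cone \<Longrightarrow> U q $ i = S (ln (F q))"
    and S: "\<And>s. (S has_real_derivative S1 s) (at s)" "\<And>s. (S1 has_real_derivative S2 s) (at s)"
    and pos: "\<And>q. q \<in> past_cone \<Longrightarrow> F q > 0"
    and F1: "\<And>q. q \<in> past_cone \<Longrightarrow> (F has_derivative F1 q) (at q)"
    and F2: "\<And>q. q \<in> past_cone \<Longrightarrow> ((\<lambda>q. F1 q v) has_derivative F2 q) (at q)"
  shows "cone_deriv v (component U i) p = S1 (ln (F p)) * (F1 p v / F p)"
    and "cone_deriv v (cone_deriv v (component U i)) p =
      S2 (ln (F p)) * (F1 p v / F p)\<^sup>2 + S1 (ln (F p)) * (F2 p v / F p - (F1 p v / F p)\<^sup>2)"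
proof -
  have ln1: "((\<lambda>q. ln (F q)) has_derivative (\<lambda>w. F1 q w / F q)) (at q)" if "q \<in> past_cone" for q
    using F1[OF that] pos[OF that] by (auto intro!: derivative_eq_intros simp: field_simps)
  have first: "cone_deriv v (component U i) q = S1 (ln (F q)) * (F1 q v / F q)"
    if "q \<in> past_cone" for q
  proof (rule cone_deriv_eq[OF that])
    show "((\<lambda>q. S (ln (F q))) has_derivative (\<lambda>w. S1 (ln (F q)) * (F1 q w / F q))) (at q)"
      by (rule has_derivative_compose[OF ln1[OF that] S(1)[unfolded has_field_derivative_def]])
  qed (use U in \<open>simp add: component_def\<close>)
  show "cone_deriv v (component U i) p = S1 (ln (F p)) * (F1 p v / F p)"
    by (rule first[OF pc])
  show "cone_deriv v (cone_deriv v (component U i)) p =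
      S2 (ln (F p)) * (F1 p v / F p)\<^sup>2 + S1 (ln (F p)) * (F2 p v / F p - (F1 p v / F p)\<^sup>2)"
  proof (subst cone_deriv_eq[OF pc _ first])
    have "((\<lambda>q. S1 (ln (F q))) has_derivative (\<lambda>w. S2 (ln (F p)) * (F1 p w / F p))) (at p)"
      by (rule has_derivative_compose[OF ln1[OF pc] S(2)[unfolded has_field_derivative_def]])
    moreover have "((\<lambda>q. F1 q v / F q) has_derivative
        (\<lambda>w. F2 p w / F p - F1 p v * F1 p w / (F p)\<^sup>2)) (at p)"
      using F1[OF pc] F2[OF pc] pos[OF pc]
      by (auto intro!: derivative_eq_intros simp: field_simps power2_eq_square)
    ultimately show "((\<lambda>q. S1 (ln (F q)) * (F1 q v / F q)) has_derivative
        (\<lambda>w. S1 (ln (F p)) * (F2 p w / F p - F1 p v * F1 p w / (F p)\<^sup>2) +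
              S2 (ln (F p)) * (F1 p w / F p) * (F1 p v / F p))) (at p)"
      by (rule has_derivative_mult)
  qed (simp_all add: power2_eq_square algebra_simps)
qed

text \<open>The logarithmic substitution: with \<open>\<theta> = ln F\<close> both equations are multiples of
  \<open>\<box> \<theta> - (\<partial>\<^sub>t \<theta>)\<^sup>2 + \<bar>\<nabla> \<theta>\<bar>\<^sup>2 = \<box> F / F\<close>.\<close>

lemma solves_system_of_wave:
  fixes F :: "real \<times> (real^'d) \<Rightarrow> real"
  assumes U: "\<And>q. q \<in> past_cone \<Longrightarrow> U q = vector [sin (ln (F q)), cos (ln (F q))]"
    and pos: "\<And>q. q \<in> past_cone \<Longrightarrow> F q > 0"
    and F1: "\<And>q. q \<in> past_cone \<Longrightarrow> (F has_derivative F1 q) (at q)"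
    and F2: "\<And>q v. q \<in> past_cone \<Longrightarrow> ((\<lambda>q. F1 q v) has_derivative F2 q v) (at q)"
    and wave: "\<And>q. q \<in> past_cone \<Longrightarrow>
      F2 q (1, 0) (1, 0) = (\<Sum>i\<in>UNIV. F2 q (0, axis i 1) (0, axis i 1))"
  shows "solves_system U"
  unfolding solves_system_def
proof
  fix p :: "real \<times> (real^'d)" assume p: "p \<in> past_cone"
  define s where "s = sin (ln (F p))"
  define c where "c = cos (ln (F p))"
  \<comment> \<open>\<open>a\<close> and \<open>b\<close> are the components of the gradient of \<open>ln F\<close>; \<open>a2 = \<partial>\<^sub>t\<^sup>2 F / F\<close>, and \<open>b2\<close> sums to \<open>\<Delta> F / F\<close>\<close>
  define a where "a = F1 p (1, 0) / F p"
  define b where "b = (\<lambda>i. F1 p (0, axis i 1) / F p)"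
  define a2 where "a2 = F2 p (1, 0) (1, 0) / F p"
  define b2 where "b2 = (\<lambda>i. F2 p (0, axis i 1) (0, axis i 1) / F p)"
  define B where "B = (\<Sum>i\<in>UNIV. (b i)\<^sup>2)"
  have U1: "U q $ 1 = sin (ln (F q))" and U2: "U q $ 2 = cos (ln (F q))" if "q \<in> past_cone" for q
    using U[OF that] by simp_all
  have sin': "(sin has_real_derivative cos t) (at t)" "(cos has_real_derivative - sin t) (at t)"
    "((\<lambda>t. - sin t) has_real_derivative - cos t) (at t)" for t :: real
    by (auto intro!: derivative_eq_intros)
  note D1 = cone_deriv_component[OF p U1 sin'(1) sin'(2) pos F1 F2]
  note D2 = cone_deriv_component[OF p U2 sin'(2) sin'(3) pos F1 F2]
  have sum_b2: "(\<Sum>i\<in>UNIV. b2 i) = a2"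
    using wave[OF p] by (simp add: a2_def b2_def sum_divide_distrib)
  have sc: "s\<^sup>2 + c\<^sup>2 = 1" by (simp add: s_def c_def)
  have norm_grad: "(norm (grad_x f p))\<^sup>2 = (\<Sum>i\<in>UNIV. (d_x i f p)\<^sup>2)" for f
    by (simp add: norm_vec_def L2_set_def grad_x_def sum_nonneg)
  have "Q_form U p = - (c * a)\<^sup>2 + (\<Sum>i\<in>UNIV. (c * b i)\<^sup>2) + (- (- s * a)\<^sup>2 + (\<Sum>i\<in>UNIV. (- s * b i)\<^sup>2))"
    by (simp add: Q_form_def sum_2 norm_grad d_t_def d_x_def D1 D2 a_def b_def s_def c_def)
  also have "\<dots> = (s\<^sup>2 + c\<^sup>2) * (B - a\<^sup>2)"
    by (simp add: power_mult_distrib B_def sum_distrib_left[symmetric] algebra_simps)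
  finally have Q: "Q_form U p = B - a\<^sup>2" using sc by simp
  have tt: "d_t (d_t (component U 1)) p = - s * a\<^sup>2 + c * (a2 - a\<^sup>2)"
    "d_t (d_t (component U 2)) p = - c * a\<^sup>2 + - s * (a2 - a\<^sup>2)"
    by (simp_all add: d_t_def D1 D2 a_def a2_def s_def c_def)
  have lap: "laplace_x (component U 1) p = (\<Sum>i\<in>UNIV. - s * (b i)\<^sup>2 + c * (b2 i - (b i)\<^sup>2))"
    "laplace_x (component U 2) p = (\<Sum>i\<in>UNIV. - c * (b i)\<^sup>2 + - s * (b2 i - (b i)\<^sup>2))"
    by (simp_all add: laplace_x_def d_x_def D1 D2 b_def b2_def s_def c_def)
  have lap: "laplace_x (component U 1) p = - s * B + c * (a2 - B)"
    "laplace_x (component U 2) p = - c * B + - s * (a2 - B)"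
    unfolding lap B_def sum_b2[symmetric]
    by (simp_all add: sum.distrib sum_subtractf sum_negf flip: sum_distrib_left)
  show "- d_t (d_t (component U 1)) p + laplace_x (component U 1) p + (U p $ 1 + U p $ 2) * Q_form U p = 0 \<and>
     - d_t (d_t (component U 2)) p + laplace_x (component U 2) p + (U p $ 2 - U p $ 1) * Q_form U p = 0 \<and>
     (U p $ 1)\<^sup>2 + (U p $ 2)\<^sup>2 = 1"
    unfolding tt lap Q U1[OF p] U2[OF p] s_def[symmetric] c_def[symmetric] using sc
    by (simp add: algebra_simps)
qed

section \<open>The hypergeometric polynomial\<close>

definition hyp_coeff :: "nat \<Rightarrow> nat \<Rightarrow> nat \<Rightarrow> real" where
  "hyp_coeff d n j = pochhammer (- (real n / 2)) j * pochhammer ((1 - real n) / 2) j /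
     (pochhammer (real d / 2) j * fact j)"

lemma hyp_coeff_0 [simp]: "hyp_coeff d n 0 = 1"
  by (simp add: hyp_coeff_def)

text \<open>The ratio of consecutive hypergeometric coefficients, cleared of denominators. The left factor
  is what the Laplacian produces from \<open>\<bar>x\<bar>\<^bsup>2 j + 2\<^esup>\<close>, the right one what \<open>\<partial>\<^sub>t\<^sup>2\<close> produces from
  \<open>(- t)\<^bsup>n - 2 j\<^esup>\<close>.\<close>

lemma hyp_coeff_Suc:
  assumes "d > 0"
  shows "hyp_coeff d n (Suc j) * (2 * real (Suc j) * (real d + 2 * real j)) =
    hyp_coeff d n j * ((real n - 2 * real j) * (real n - 2 * real j - 1))"
proof -
  have P: "pochhammer (real d / 2) k > 0" for k
    using assms by (intro pochhammer_pos) simp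
  define P1 P2 P3 where "P1 = pochhammer (- (real n / 2)) j"
    and "P2 = pochhammer ((1 - real n) / 2) j" and "P3 = pochhammer (real d / 2) j"
  have nz: "P3 \<noteq> 0" "real d / 2 + real j \<noteq> 0" "(1 + real j) \<noteq> 0" "(fact j :: real) \<noteq> 0"
    using P[of j] assms by (auto simp: P3_def)
  define X D where "X = (- (real n / 2) + real j) * ((1 - real n) / 2 + real j)"
    and "D = (real d / 2 + real j) * (1 + real j)"
  have "D \<noteq> 0" using nz by (simp add: D_def)
  have "hyp_coeff d n (Suc j) = (P1 * (- (real n / 2) + real j)) * (P2 * ((1 - real n) / 2 + real j)) /
      ((P3 * (real d / 2 + real j)) * ((1 + real j) * fact j))"
    by (simp add: hyp_coeff_def pochhammer_Suc P1_def P2_def P3_def)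
  also have "\<dots> = (P1 * P2 * X) / (P3 * fact j * D)"
    by (simp only: X_def D_def mult_ac)
  also have "\<dots> = hyp_coeff d n j * X / D"
    by (simp add: hyp_coeff_def P1_def P2_def P3_def)
  finally have "hyp_coeff d n (Suc j) * (4 * D) = hyp_coeff d n j * (4 * X)"
    using \<open>D \<noteq> 0\<close> by simp
  moreover have "4 * D = 2 * real (Suc j) * (real d + 2 * real j)"
    by (simp add: D_def algebra_simps)
  moreover have "4 * X = (real n - 2 * real j) * (real n - 2 * real j - 1)"
    by (simp add: X_def field_simps)
  ultimately show ?thesis by simp
qed

text \<open>The factor in the recursion is a product of two consecutive integers, hence never negative,
  whatever the sign of \<open>n - 2 j\<close>.\<close>

lemma hyp_coeff_nonneg:
  assumes "d > 0"
  shows "hyp_coeff d n j \<ge> 0"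
proof (induction j)
  case (Suc j)
  define m where "m = int n - 2 * int j"
  have "m * (m - 1) \<ge> 0"
    by (cases "m \<ge> 1") (auto simp: mult_nonneg_nonneg mult_nonpos_nonpos)
  then have "real_of_int (m * (m - 1)) \<ge> 0" by (simp only: of_int_0_le_iff)
  then have "(real n - 2 * real j) * (real n - 2 * real j - 1) \<ge> 0" by (simp add: m_def)
  with Suc have "hyp_coeff d n (Suc j) * (2 * real (Suc j) * (real d + 2 * real j)) \<ge> 0"
    unfolding hyp_coeff_Suc[OF assms] by simp
  moreover have "2 * real (Suc j) * (real d + 2 * real j) > 0" using assms by simp
  ultimately show ?case by (simp only: zero_le_mult_iff) linarith
qed simp

text \<open>The recursion factor vanishes at \<open>j = n div 2\<close>, for even and for odd \<open>n\<close>, and the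
  coefficients stay zero from there on. So the hypergeometric series is the finite sum \<open>phi\<close>, and the
  telescoping sum in \<open>wave_poly_wave_equation\<close> has no boundary term.\<close>

lemma hyp_coeff_eq_0:
  assumes "d > 0" "j > n div 2"
  shows "hyp_coeff d n j = 0"
  using assms(2)
proof (induction j)
  case (Suc j)
  have "hyp_coeff d n j * ((real n - 2 * real j) * (real n - 2 * real j - 1)) = 0"
  proof (cases "j = n div 2")
    case True
    then have "n = 2 * j \<or> n = 2 * j + 1" by linarith
    then show ?thesis by auto
  qed (use Suc in simp)
  then have "hyp_coeff d n (Suc j) * (2 * real (Suc j) * (real d + 2 * real j)) = 0"
    by (simp only: hyp_coeff_Suc[OF assms(1)])
  moreover have "real (Suc j) > 0" "real d + 2 * real j > 0" using assms(1) by simp_all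
  ultimately show ?case by (simp del: of_nat_Suc)
qed simp

lemma phi_eq: "phi d n \<rho> = (\<Sum>j = 0..n div 2. hyp_coeff d n j * \<rho> ^ (2 * j))"
  by (simp add: phi_def hyp_coeff_def)

lemma phi_pos:
  assumes "d > 0"
  shows "phi d n \<rho> > 0"
proof -
  have "0 < (\<Sum>j\<in>{0}. hyp_coeff d n j * \<rho> ^ (2 * j))" by simp
  also have "\<dots> \<le> phi d n \<rho>" unfolding phi_eq
    by (rule sum_mono2) (auto simp: hyp_coeff_nonneg[OF assms])
  finally show ?thesis .
qed

lemma phi_is_poly: "\<exists>p :: real poly. \<forall>\<rho>. phi d n \<rho> = poly p \<rho>"
  by (rule exI[of _ "\<Sum>j = 0..n div 2. monom (hyp_coeff d n j) (2 * j)"])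
    (simp add: phi_eq poly_sum poly_monom)

lemma phi_eq_hyp2F1:
  assumes "d > 0"
  shows "phi d n \<rho> = hyp2F1 ((1 - real n) / 2) (- (real n / 2)) (real d / 2) (\<rho>\<^sup>2)"
proof -
  have nth: "fps_nth (fps_hypergeo [(1 - real n) / 2, - (real n / 2)] [real d / 2] 1) j = hyp_coeff d n j" for j
    by (simp add: hyp_coeff_def)
  have "hyp2F1 ((1 - real n) / 2) (- (real n / 2)) (real d / 2) (\<rho>\<^sup>2) = (\<Sum>j. hyp_coeff d n j * (\<rho>\<^sup>2) ^ j)"
    unfolding hyp2F1_def eval_fps_def nth ..
  also have "\<dots> = (\<Sum>j = 0..n div 2. hyp_coeff d n j * (\<rho>\<^sup>2) ^ j)"
    by (rule suminf_finite) (auto simp: hyp_coeff_eq_0[OF assms])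
  finally show ?thesis by (simp add: phi_eq power_mult)
qed

lemma phi_even: "phi d n (- \<rho>) = phi d n \<rho>"
  by (simp add: phi_eq)

section \<open>A homogeneous solution of the wave equation\<close>

definition cone_mono :: "nat \<Rightarrow> nat \<Rightarrow> real \<times> 'a::real_inner \<Rightarrow> real" where
  "cone_mono a j p = (- fst p) ^ a * (snd p \<bullet> snd p) ^ j"

definition cone_mono_deriv :: "nat \<Rightarrow> nat \<Rightarrow> real \<times> 'a::real_inner \<Rightarrow> real \<times> 'a \<Rightarrow> real" where
  "cone_mono_deriv a j p v = 2 * real j * (snd p \<bullet> snd v) * cone_mono a (j - 1) p
     - real a * fst v * cone_mono (a - 1) j p"

text \<open>The derivative in direction \<open>w\<close> of the derivative in direction \<open>v\<close>. Truncated exponents are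
  harmless, since they come with a factor \<open>a\<close>, \<open>a - 1\<close>, \<open>j\<close> or \<open>j - 1\<close> that vanishes in that case.\<close>

definition cone_mono_deriv2 ::
    "nat \<Rightarrow> nat \<Rightarrow> real \<times> 'a::real_inner \<Rightarrow> real \<times> 'a \<Rightarrow> real \<times> 'a \<Rightarrow> real" where
  "cone_mono_deriv2 a j p v w =
     2 * real j * ((snd w \<bullet> snd v) * cone_mono a (j - 1) p + (snd p \<bullet> snd v) * cone_mono_deriv a (j - 1) p w)
     - real a * fst v * cone_mono_deriv (a - 1) j p w"

lemma has_derivative_cone_mono:
  "(cone_mono a j has_derivative cone_mono_deriv a j p) (at p)"
proof -
  have "((\<lambda>p. (- fst p) ^ a * (snd p \<bullet> snd p) ^ j) has_derivative cone_mono_deriv a j p) (at p)"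
    unfolding cone_mono_deriv_def cone_mono_def
    by (auto intro!: derivative_eq_intros simp: inner_commute algebra_simps)
  then show ?thesis by (simp add: cone_mono_def[abs_def])
qed

lemma has_derivative_cone_mono_deriv:
  "((\<lambda>p. cone_mono_deriv a j p v) has_derivative cone_mono_deriv2 a j p v) (at p)"
  unfolding cone_mono_deriv_def[of a j] cone_mono_deriv2_def
  by (auto intro!: derivative_eq_intros has_derivative_cone_mono simp: algebra_simps)

lemma cone_mono_dt2:
  "cone_mono_deriv2 a j p (1, 0) (1, 0) = real a * (real a - 1) * cone_mono (a - 2) j p"
  by (cases a) (auto simp: cone_mono_deriv2_def cone_mono_deriv_def numeral_2_eq_2)

text \<open>The classical formula \<open>\<Delta> \<bar>x\<bar>\<^bsup>2 j\<^esup> = 2 j (d + 2 j - 2) \<bar>x\<bar>\<^bsup>2 j - 2\<^esup>\<close>.\<close>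

lemma cone_mono_laplace:
  fixes p :: "real \<times> (real^'d)"
  shows "(\<Sum>i\<in>UNIV. cone_mono_deriv2 a j p (0, axis i 1) (0, axis i 1)) =
    2 * real j * (real CARD('d) + 2 * (real j - 1)) * cone_mono a (j - 1) p"
proof -
  have step: "cone_mono_deriv2 a j p (0, axis i 1) (0, axis i 1) = 2 * real j * cone_mono a (j - 1) p
      + 4 * real j * real (j - 1) * cone_mono a (j - 1 - 1) p * (snd p $ i)\<^sup>2" for i
    by (simp add: cone_mono_deriv2_def cone_mono_deriv_def inner_axis power2_eq_square algebra_simps)
  have q: "(\<Sum>i\<in>UNIV. (snd p $ i)\<^sup>2) = snd p \<bullet> snd p"
    by (simp add: inner_vec_def power2_eq_square)
  have "(\<Sum>i\<in>UNIV. cone_mono_deriv2 a j p (0, axis i 1) (0, axis i 1)) =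
      2 * real j * real CARD('d) * cone_mono a (j - 1) p
      + 4 * real j * real (j - 1) * (cone_mono a (j - 1 - 1) p * (snd p \<bullet> snd p))"
    unfolding step sum.distrib sum_distrib_left[symmetric] q by simp
  also have "\<dots> = 2 * real j * real CARD('d) * cone_mono a (j - 1) p
      + 4 * real j * real (j - 1) * cone_mono a (j - 1) p"
    by (cases "j - 1") (auto simp: cone_mono_def)
  finally show ?thesis by (cases j) (auto simp: algebra_simps)
qed

definition wave_poly :: "nat \<Rightarrow> real \<times> (real^'d) \<Rightarrow> real" where
  "wave_poly n p = (\<Sum>j = 0..n div 2. hyp_coeff CARD('d) n j * cone_mono (n - 2 * j) j p)"

definition wave_poly_deriv :: "nat \<Rightarrow> real \<times> (real^'d) \<Rightarrow> real \<times> (real^'d) \<Rightarrow> real" where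
  "wave_poly_deriv n p v = (\<Sum>j = 0..n div 2. hyp_coeff CARD('d) n j * cone_mono_deriv (n - 2 * j) j p v)"

definition wave_poly_deriv2 ::
    "nat \<Rightarrow> real \<times> (real^'d) \<Rightarrow> real \<times> (real^'d) \<Rightarrow> real \<times> (real^'d) \<Rightarrow> real" where
  "wave_poly_deriv2 n p v w =
     (\<Sum>j = 0..n div 2. hyp_coeff CARD('d) n j * cone_mono_deriv2 (n - 2 * j) j p v w)"

lemma has_derivative_wave_poly:
  "(wave_poly n has_derivative wave_poly_deriv n p) (at p)"
  "((\<lambda>p. wave_poly_deriv n p v) has_derivative wave_poly_deriv2 n p v) (at p)"
  unfolding wave_poly_def[abs_def] wave_poly_deriv_def wave_poly_deriv2_def
  by (intro has_derivative_sum has_derivative_mult_right has_derivative_cone_mono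
      has_derivative_cone_mono_deriv)+

text \<open>By the recursion for the coefficients, the second time derivative of the term with index \<open>j\<close> is
  the Laplacian of the term with index \<open>j + 1\<close>. The term with index \<open>0\<close> is independent of \<open>x\<close>, and the
  coefficient after the last one vanishes, so the two sums agree after a shift of the index.\<close>

lemma wave_poly_wave_equation:
  fixes p :: "real \<times> (real^'d)"
  shows "wave_poly_deriv2 n p (1, 0) (1, 0) =
    (\<Sum>i\<in>UNIV. wave_poly_deriv2 n p (0, axis i 1) (0, axis i 1))"
proof -
  let ?c = "hyp_coeff CARD('d) n"
  \<comment> \<open>the Laplacian of the term with index \<open>j\<close>\<close>
  define T where "T j = ?c j * (2 * real j * (real CARD('d) + 2 * (real j - 1)) * cone_mono (n - 2 * j) (j - 1) p)" for j
  have "?c j * cone_mono_deriv2 (n - 2 * j) j p (1, 0) (1, 0) = T (Suc j)" if "j \<in> {0..n div 2}" for j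
  proof -
    have r: "real (n - 2 * j) = real n - 2 * real j" using that by auto
    have "?c j * cone_mono_deriv2 (n - 2 * j) j p (1, 0) (1, 0) =
        (?c j * ((real n - 2 * real j) * (real n - 2 * real j - 1))) * cone_mono (n - 2 * j - 2) j p"
      by (simp add: cone_mono_dt2 r)
    also have "\<dots> = ?c (Suc j) * (2 * real (Suc j) * (real CARD('d) + 2 * real j)) * cone_mono (n - 2 * j - 2) j p"
      by (simp only: hyp_coeff_Suc[OF zero_less_card_finite])
    also have "\<dots> = T (Suc j)" by (simp add: T_def)
    finally show ?thesis .
  qed
  then have "wave_poly_deriv2 n p (1, 0) (1, 0) = (\<Sum>j = 0..n div 2. T (Suc j))"
    unfolding wave_poly_deriv2_def by (rule sum.cong[OF refl])
  also have "\<dots> = (\<Sum>j = 0..n div 2. T j)"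
  proof -
    have "T (Suc (n div 2)) = 0" by (simp add: T_def hyp_coeff_eq_0)
    moreover have "T 0 = 0" by (simp add: T_def)
    ultimately show ?thesis
      using sum.atLeast0_atMost_Suc[of T "n div 2"] sum.atLeast0_atMost_Suc_shift[of T "n div 2"] by (simp add: o_def)
  qed
  also have "\<dots> = (\<Sum>j = 0..n div 2. ?c j * (\<Sum>i\<in>UNIV. cone_mono_deriv2 (n - 2 * j) j p (0, axis i 1) (0, axis i 1)))"
    by (simp add: T_def cone_mono_laplace)
  also have "\<dots> = (\<Sum>i\<in>UNIV. wave_poly_deriv2 n p (0, axis i 1) (0, axis i 1))"
    unfolding wave_poly_deriv2_def sum_distrib_left by (rule sum.swap)
  finally show ?thesis .
qed

text \<open>Homogeneity of degree \<open>n\<close>. It yields positivity of the wave polynomial and the formula for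
  the phase in similarity coordinates.\<close>

lemma wave_poly_eq_phi:
  fixes x :: "real^'d"
  assumes "t < 0"
  shows "wave_poly n (t, x) = (- t) ^ n * phi CARD('d) n (norm (x /\<^sub>R (- t)))"
proof -
  have "cone_mono (n - 2 * j) j (t, x) = (- t) ^ n * norm (x /\<^sub>R (- t)) ^ (2 * j)"
    if "j \<in> {0..n div 2}" for j
  proof -
    define r where "r = - t"
    have r: "r > 0" using assms by (simp add: r_def)
    have "n = (n - 2 * j) + 2 * j" using that by auto
    then have "r ^ n = r ^ (n - 2 * j) * r ^ (2 * j)" by (metis power_add)
    moreover have "norm (x /\<^sub>R r) = norm x / r" using r by (simp add: field_simps)
    moreover have "(x \<bullet> x) ^ j = norm x ^ (2 * j)" by (simp add: dot_square_norm power_mult)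
    ultimately show ?thesis
      using r by (simp add: cone_mono_def r_def[symmetric] power_divide)
  qed
  then show ?thesis by (simp add: wave_poly_def phi_eq sum_distrib_left mult.left_commute)
qed

lemma C_on_cone_mono:
  fixes f :: "'a::real_normed_vector \<Rightarrow> real \<times> 'b::real_inner"
  assumes "open V" "C_on k V f"
  shows "C_on k V (\<lambda>p. cone_mono a j (f p))"
proof -
  have "bounded_linear (\<lambda>q :: real \<times> 'b. - fst q)"
    by (intro bounded_linear_minus bounded_linear_fst)
  then show ?thesis unfolding cone_mono_def
    by (intro C_on_mult C_on_power C_on_bilinear[OF _ bounded_bilinear_inner] assms(1)
        C_on_bounded_linear[OF assms(1) bounded_linear_snd]
        C_on_bounded_linear[where L = "\<lambda>q. - fst q"] assms)
qed

lemma C_on_wave_poly: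
  assumes "open V" "C_on k V f"
  shows "C_on k V (\<lambda>p. wave_poly n (f p))"
  unfolding wave_poly_def by (intro C_on_sum C_on_mult C_on_const C_on_cone_mono assms)

lemma wave_poly_pos: "t < 0 \<Longrightarrow> wave_poly n (t, x) > 0"
  by (simp add: wave_poly_eq_phi phi_pos)

section \<open>Discreteness and loss of smoothness\<close>

text \<open>Taking logarithms turns the set into integer multiples of \<open>a\<close>, which are at least \<open>a\<close> apart.\<close>

lemma discrete_geometric_progression:
  fixes a :: real
  assumes "a > 0"
  shows "discrete {\<mu>. \<mu> > 0 \<and> \<mu> \<noteq> 1 \<and> (\<exists>k::int. ln \<mu> = a * real_of_int k)}" (is "discrete ?S")
proof (rule discreteI)
  fix x assume x: "x \<in> ?S"
  let ?T = "{exp (ln x - a) <..< exp (ln x + a)}"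
  have uniq: "y = x" if y: "y \<in> ?T" "y \<in> ?S" for y
  proof -
    have "y > 0" "x > 0" using x y by auto
    obtain k m :: int where k: "ln x = a * real_of_int k" "ln y = a * real_of_int m" using x y by auto
    have "exp (ln x - a) < exp (ln y)" "exp (ln y) < exp (ln x + a)"
      using y(1) \<open>y > 0\<close> by simp_all
    then have "ln x - a < ln y" "ln y < ln x + a" by (simp_all only: exp_less_cancel_iff)
    then have "a * (real_of_int k - 1) < a * real_of_int m" "a * real_of_int m < a * (real_of_int k + 1)"
      unfolding k by (simp_all add: algebra_simps)
    then have "real_of_int k - 1 < real_of_int m" "real_of_int m < real_of_int k + 1"
      using assms by (simp_all only: mult_less_cancel_left_pos)
    then have "k = m" by linarith
    then show "y = x" using k \<open>x > 0\<close> \<open>y > 0\<close> by (metis ln_inj_iff)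
  qed
  have "x = exp (ln x)" using x by simp
  then have "x \<in> ?T" using assms
    by (metis add.commute diff_less_eq exp_less_cancel_iff greaterThanLessThan_iff less_add_same_cancel2)
  with uniq x have "?T \<inter> ?S = {x}" by blast
  then show "x isolated_in ?S"
    unfolding isolated_in_def using x open_greaterThanLessThan by blast
qed

text \<open>If \<open>U\<close> takes two different values along two sequences on the axis that tend to the origin, then
  no continuous function near the origin, let alone a smooth one, can agree with \<open>U\<close> on the cone.\<close>

lemma blows_up_at_origin_of_two_limits:
  fixes U :: "real \<times> (real^'d) \<Rightarrow> real^2"
  assumes "b > 0" "u \<noteq> u'"
    and u: "\<And>k. U (- exp (- (a + b * real k)), 0) = u"
    and u': "\<And>k. U (- exp (- (a' + b * real k)), 0) = u'"
  shows "blows_up_at_origin U"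
  unfolding blows_up_at_origin_def
proof
  assume "\<exists>N g. open N \<and> (0, 0) \<in> N \<and> smooth_on N g \<and> (\<forall>p\<in>N \<inter> past_cone. g p = U p)"
  then obtain N g where N: "open N" "(0, 0) \<in> N" and g: "smooth_on N g"
    and gU: "\<And>p. p \<in> N \<Longrightarrow> p \<in> past_cone \<Longrightarrow> g p = U p" by blast
  obtain V h where "N \<subseteq> V" "C_on 0 V h" "\<And>p. p \<in> N \<Longrightarrow> h p = g p"
    using g unfolding smooth_on_def by metis
  then have "continuous_on N g" by (metis C_on.simps(1) continuous_on_cong continuous_on_subset)
  then have cont: "isCont g (0, 0)" using N continuous_on_eq_continuous_at by blast
  have "w = g (0, 0)" if w: "\<And>k. U (- exp (- (c + b * real k)), 0) = w" for c w
  proof -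
    let ?p = "\<lambda>k. (- exp (- (c + b * real k)), 0) :: real \<times> (real^'d)"
    have "(\<lambda>k. exp (- c) * exp (- b) ^ k) \<longlonglongrightarrow> exp (- c) * 0"
      using assms(1) by (intro tendsto_mult tendsto_const LIMSEQ_realpow_zero) auto
    moreover have "exp (- c) * exp (- b) ^ k = exp (- (c + b * real k))" for k
      by (simp add: exp_add[symmetric] exp_of_nat_mult[symmetric] algebra_simps)
    ultimately have "(\<lambda>k. - exp (- (c + b * real k))) \<longlonglongrightarrow> 0"
      using tendsto_minus[of _ "0::real"] by fastforce
    then have p: "?p \<longlonglongrightarrow> (0, 0)" by (intro tendsto_Pair tendsto_const)
    then have "\<forall>\<^sub>F k in sequentially. ?p k \<in> N" using N by (rule topological_tendstoD)
    then have "\<forall>\<^sub>F k in sequentially. g (?p k) = w"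
    proof eventually_elim
      case (elim k)
      then show ?case using gU[OF elim] w[of k] by (simp add: past_cone_def)
    qed
    then have "(\<lambda>k. g (?p k)) \<longlonglongrightarrow> w" by (rule tendsto_eventually)
    moreover have "(\<lambda>k. g (?p k)) \<longlonglongrightarrow> g (0, 0)"
      by (rule isCont_tendsto_compose[OF cont p])
    ultimately show ?thesis using LIMSEQ_unique by blast
  qed
  from this[OF u] this[OF u'] show False using \<open>u \<noteq> u'\<close> by simp
qed

section \<open>The profiles\<close>

definition profile :: "nat \<Rightarrow> real \<Rightarrow> real^'d \<Rightarrow> real^2" where
  "profile n \<tau> \<xi> = vector [sin (ln (phi CARD('d) n (norm \<xi>)) - real n * \<tau>),
                          cos (ln (phi CARD('d) n (norm \<xi>)) - real n * \<tau>)]"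

lemma norm_profile: "norm (profile n \<tau> \<xi>) = 1"
  by (simp add: profile_def norm_vec_def L2_set_def sum_2)

text \<open>Time shifts decide everything about invariance: they give the period of the profile, and a
  rescaling by \<open>\<mu>\<close> is the shift by \<open>ln \<mu>\<close> in similarity coordinates.\<close>

lemma profile_shift_eq_iff:
  fixes \<xi> :: "real^'d"
  shows "profile n (\<tau> + s) \<xi> = profile n \<tau> \<xi> \<longleftrightarrow> (\<exists>k::int. real n * s = 2 * pi * real_of_int k)"
proof -
  define \<theta> where "\<theta> = ln (phi CARD('d) n (norm \<xi>)) - real n * \<tau>"
  have "ln (phi CARD('d) n (norm \<xi>)) - real n * (\<tau> + s) = \<theta> - real n * s"
    by (simp add: \<theta>_def algebra_simps)
  then have "profile n (\<tau> + s) \<xi> = profile n \<tau> \<xi> \<longleftrightarrow>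
      sin \<theta> = sin (\<theta> - real n * s) \<and> cos \<theta> = cos (\<theta> - real n * s)"
    by (auto simp: profile_def \<theta>_def[symmetric] vec_eq_iff forall_2)
  then show ?thesis unfolding sin_cos_eq_iff by (auto simp: algebra_simps)
qed

text \<open>Shifting by half a period gives the second value on the axis for the blowup argument.\<close>

lemma profile_half_period:
  fixes \<xi> :: "real^'d"
  assumes "real n * s = pi"
  shows "profile n (\<tau> + s) \<xi> = - profile n \<tau> \<xi>"
proof -
  define \<theta> where "\<theta> = ln (phi CARD('d) n (norm \<xi>)) - real n * \<tau>"
  have "ln (phi CARD('d) n (norm \<xi>)) - real n * (\<tau> + s) = \<theta> - pi"
    using assms by (simp add: \<theta>_def algebra_simps)
  then show ?thesis
    by (simp add: profile_def \<theta>_def[symmetric] vec_eq_iff forall_2 sin_diff cos_diff)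
qed

lemma of_profile_eq_wave_poly:
  assumes "fst p < 0"
  shows "of_profile (profile n) p =
    vector [sin (ln (wave_poly n p)), cos (ln (wave_poly n p))]"
proof -
  obtain t x where p: "p = (t, x)" by (cases p)
  have "t < 0" using assms p by simp
  have "ln (wave_poly n p) = ln (phi CARD('a) n (norm (x /\<^sub>R (- t)))) - real n * (- ln (- t))"
    using \<open>t < 0\<close> phi_pos[of "CARD('a)" n "norm (x /\<^sub>R (- t))"]
    by (simp add: p wave_poly_eq_phi ln_mult ln_realpow)
  then show ?thesis by (simp add: p of_profile_def profile_def)
qed

lemma solves_system_profile: "solves_system (of_profile (profile n))"
proof (rule solves_system_of_wave[where F = "wave_poly n" and ?F1.0 = "wave_poly_deriv n"
      and ?F2.0 = "wave_poly_deriv2 n"])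
  fix q :: "real \<times> (real^'a)" assume "q \<in> past_cone"
  then have q: "fst q < 0" by (auto simp: past_cone_def)
  show "of_profile (profile n) q = vector [sin (ln (wave_poly n q)), cos (ln (wave_poly n q))]"
    by (rule of_profile_eq_wave_poly[OF q])
  show "wave_poly n q > 0" using wave_poly_pos[OF q, of n "snd q"] by simp
qed (rule has_derivative_wave_poly wave_poly_wave_equation)+

lemma smooth_on_of_profile: "smooth_on past_cone (of_profile (profile n))"
  unfolding smooth_on_def
proof (intro exI conjI allI ballI)
  let ?V = "{p :: real \<times> (real^'a). fst p < 0}"
  let ?g = "\<lambda>p :: real \<times> (real^'a). vector [sin (ln (wave_poly n p)), cos (ln (wave_poly n p))] :: real^2"
  show V: "open ?V" by (intro open_Collect_less continuous_intros)
  show "past_cone \<subseteq> ?V" by (auto simp: past_cone_def)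
  show "C_on k ?V ?g" for k
    by (intro C_on_circle C_on_ln C_on_wave_poly C_on_id V) (auto simp: wave_poly_pos)
  show "?g p = of_profile (profile n) p" if "p \<in> past_cone" for p
    using that by (subst of_profile_eq_wave_poly) (auto simp: past_cone_def)
qed

text \<open>A polynomial in the norm need not look smooth at \<open>\<xi> = 0\<close>. It is smooth here because \<open>phi\<close> is
  even: \<open>phi (norm \<xi>)\<close> is the value of the wave polynomial at the point \<open>(- 1, \<xi>)\<close>.\<close>

lemma smooth_on_profile:
  "smooth_on (UNIV \<times> S) (\<lambda>(\<tau>, \<xi>). profile n \<tau> \<xi> $ i)"
  unfolding smooth_on_def
proof (intro exI conjI allI ballI)
  let ?phase = "\<lambda>p :: real \<times> (real^'a). ln (wave_poly n ((- 1, 0) + (0, snd p))) + - real n * fst p"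
  let ?g = "\<lambda>p. (vector [sin (?phase p), cos (?phase p)] :: real^2) $ i"
  have L: "bounded_linear (\<lambda>p :: real \<times> (real^'a). (0 :: real, snd p))"
    by (intro bounded_linear_Pair bounded_linear_zero bounded_linear_snd)
  show "C_on k UNIV ?g" for k
    by (intro C_on_bounded_linear[OF _ bounded_linear_vec_nth] C_on_circle C_on_add C_on_ln
        C_on_wave_poly C_on_mult C_on_const C_on_bounded_linear[OF _ L]
        C_on_bounded_linear[OF _ bounded_linear_fst] C_on_id open_UNIV) (auto simp: wave_poly_pos)
  show "?g p = (case p of (\<tau>, \<xi>) \<Rightarrow> profile n \<tau> \<xi> $ i)" for p
    by (cases p) (simp add: wave_poly_eq_phi profile_def)
qed auto

lemma rescale_profile:
  assumes "fst p < 0" "\<mu> > 0"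
  shows "rescale \<mu> (of_profile w) p = w (- ln (- fst p) + ln \<mu>) (snd p /\<^sub>R (- fst p))"
proof -
  obtain t x where p: "p = (t, x)" by (cases p)
  have "ln (- t / \<mu>) = ln (- t) - ln \<mu>" using assms p by (intro ln_divide_pos) auto
  then have "- ln (- (t / \<mu>)) = - ln (- t) + ln \<mu>" by simp
  moreover have "(x /\<^sub>R \<mu>) /\<^sub>R (- (t / \<mu>)) = x /\<^sub>R (- t)" using assms by (simp add: field_simps)
  ultimately show ?thesis unfolding p rescale_def of_profile_def by (simp only: prod.case fst_conv snd_conv)
qed

lemma discretely_self_similar_profile:
  assumes "n \<ge> 1"
  shows "discretely_self_similar (of_profile (profile n) :: real \<times> (real^'d) \<Rightarrow> real^2)"
proof -
  let ?U = "of_profile (profile n) :: real \<times> (real^'d) \<Rightarrow> real^2"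
  let ?a = "2 * pi / real n"
  have a: "?a > 0" using assms by simp
  have *: "(\<forall>p\<in>past_cone. ?U p = rescale \<mu> ?U p) \<longleftrightarrow> (\<exists>k::int. ln \<mu> = ?a * real_of_int k)"
    if "\<mu> > 0" for \<mu>
  proof -
    have "?U p = rescale \<mu> ?U p \<longleftrightarrow> (\<exists>k::int. ln \<mu> = ?a * real_of_int k)" if p: "p \<in> past_cone" for p
    proof -
      have t: "fst p < 0" using p by (auto simp: past_cone_def)
      have "?U p = profile n (- ln (- fst p)) (snd p /\<^sub>R (- fst p))"
        by (simp add: of_profile_def case_prod_unfold)
      then have "?U p = rescale \<mu> ?U p \<longleftrightarrow> (\<exists>k::int. real n * ln \<mu> = 2 * pi * real_of_int k)"
        unfolding rescale_profile[OF t \<open>\<mu> > 0\<close>] using profile_shift_eq_iff by metis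
      then show ?thesis using assms by (simp add: field_simps)
    qed
    moreover have "(-1, 0) \<in> (past_cone :: (real \<times> (real^'d)) set)" by (simp add: past_cone_def)
    ultimately show ?thesis by blast
  qed
  have "{\<mu>. \<mu> > 0 \<and> \<mu> \<noteq> 1 \<and> (\<forall>p\<in>past_cone. ?U p = rescale \<mu> ?U p)} =
      {\<mu>. \<mu> > 0 \<and> \<mu> \<noteq> 1 \<and> (\<exists>k::int. ln \<mu> = ?a * real_of_int k)}" (is "_ = ?S")
    using * by blast
  moreover have "exp ?a \<in> ?S" using a assms by (auto intro!: exI[of _ 1])
  then have "?S \<noteq> {}" by blast
  moreover note discrete_geometric_progression[OF a]
  ultimately show ?thesis unfolding discretely_self_similar_def by (simp only: Let_def simp_thms)
qed

lemma blows_up_profile: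
  assumes "n \<ge> 1"
  shows "blows_up_at_origin (of_profile (profile n) :: real \<times> (real^'d) \<Rightarrow> real^2)"
proof (rule blows_up_at_origin_of_two_limits)
  let ?w = "profile n 0 (0 :: real^'d)"
  let ?b = "2 * pi / real n"
  show "?b > 0" using assms by simp
  have "?w \<noteq> 0" using norm_profile[of n 0 "0 :: real^'d"] by auto
  then show "?w \<noteq> - ?w" by (metis eq_neg_iff_add_eq_0 scaleR_2 scaleR_eq_0_iff zero_neq_numeral)
  have U: "of_profile (profile n) (- exp (- s), 0 :: real^'d) = profile n s (0 :: real^'d)" for s
    by (simp add: of_profile_def)
  have per: "profile n (s + ?b * real k) (0 :: real^'d) = profile n s (0 :: real^'d)" for s k
    unfolding profile_shift_eq_iff using assms by (auto intro!: exI[of _ "int k"])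
  show "of_profile (profile n) (- exp (- (0 + ?b * real k)), 0 :: real^'d) = ?w" for k
    unfolding U by (rule per)
  show "of_profile (profile n) (- exp (- (pi / real n + ?b * real k)), 0 :: real^'d) = - ?w" for k
    unfolding U per using profile_half_period[of n "pi / real n" 0 "0 :: real^'d"] assms by simp
qed

theorem theorem1p2:
  shows "\<exists>W :: nat \<Rightarrow> real \<Rightarrow> real^'d \<Rightarrow> real^2. \<forall>n\<ge>1.
    (\<forall>\<tau>. \<forall>\<xi>\<in>cball 0 1. W n \<tau> \<xi> \<in> sphere 0 1) \<and>
    (\<forall>i. smooth_on (UNIV \<times> cball 0 1) (\<lambda>(\<tau>, \<xi>). W n \<tau> \<xi> $ i)) \<and>
    (\<exists>T>0. \<forall>\<tau>. \<forall>\<xi>\<in>cball 0 1. W n (\<tau> + T) \<xi> = W n \<tau> \<xi>) \<and>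
    solves_system (of_profile (W n)) \<and>
    discretely_self_similar (of_profile (W n)) \<and>
    smooth_on past_cone (of_profile (W n)) \<and>
    blows_up_at_origin (of_profile (W n)) \<and>
    (\<forall>\<tau>. \<forall>\<xi>\<in>cball 0 1. W n \<tau> \<xi> =
       vector [sin (ln (phi CARD('d) n (norm \<xi>)) - real n * \<tau>),
               cos (ln (phi CARD('d) n (norm \<xi>)) - real n * \<tau>)]) \<and>
    (\<forall>\<rho>. phi CARD('d) n \<rho> > 0) \<and>
    (\<forall>\<rho>. phi CARD('d) n (- \<rho>) = phi CARD('d) n \<rho>) \<and>
    (\<exists>p :: real poly. \<forall>\<rho>. phi CARD('d) n \<rho> = poly p \<rho>) \<and>
    (\<forall>\<rho>. phi CARD('d) n \<rho> =
       hyp2F1 ((1 - real n) / 2) (- (real n / 2)) (real CARD('d) / 2) (\<rho>\<^sup>2))"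
proof (intro exI[of _ profile] allI impI conjI ballI)
  fix n :: nat assume n: "n \<ge> 1"
  show "\<exists>T>0. \<forall>\<tau>. \<forall>\<xi>\<in>cball 0 1. profile n (\<tau> + T) \<xi> = profile n \<tau> (\<xi> :: real^'d)"
    unfolding profile_shift_eq_iff using n by (auto intro!: exI[of _ "2 * pi / real n"] exI[of _ "1::int"])
qed (auto simp: norm_profile discretely_self_similar_profile blows_up_profile phi_pos phi_even
    intro: smooth_on_profile solves_system_profile smooth_on_of_profile profile_def phi_is_poly
      phi_eq_hyp2F1)

end
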